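(* Let $\alpha$ be a simplex of a vertex triangulation of a simplotope $\Pi(c_1,\dots,c_n)$ (with $N=c_1+\cdots+c_n$). Then the class of $\alpha$, defined as $|\det[\mathbf 1\mid M_{\mathbf v}]|$ where $M_{\mathbf v}$ is the $(N+1)\times N$ matrix whose rows are the reduced coordinates with respect to a vertex $\mathbf v$ of the simplotope of the vertices of $\alpha$ and $\mathbf 1$ is a column of ones, does not depend on the choice of the vertex $\mathbf v$.
   Context: $\Delta^d$ is the convex hull of the standard unit vectors of $\mathbb{R}^{d+1}$ and $\Pi(c_1,\dots,c_n)=\Delta^{c_1}\times\cdots\times\Delta^{c_n}$, written in standard coordinates $(\mathbf x^1;\dots;\mathbf x^n)$ with $\mathbf x^i=(x^i_1,\dots,x^i_{c_i+1})\in\Delta^{c_i}$. Its vertices are the points with all coordinates in $\{0,1\}$. For a vertex $\mathbf v$, the reduced coordinates of a point with respect to $\mathbf v$ are obtained from its standard coordinates by deleting, in each factor $i$, the unique coordinate $x^i_j$ at which $\mathbf v$ equals $1$; this gives a vector in $\mathbb{R}^N$. A vertex triangulation of a polytope is a triangulation (decomposition into simplices meeting face-to-face) all of whose vertices are vertices of the polytope. *)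

theory Defs
  imports "HOL-Analysis.Analysis" "Jordan_Normal_Form.Determinant"
begin

text \<open>
  The ambient space of the simplotope is \<open>real^'k\<close>, where the finite type \<open>'k\<close> indexes the standard
  coordinates: \<open>pos (i, j)\<close> is the index of the coordinate written \<open>x\<^sup>i\<^sub>j\<close>, and \<open>pos\<close> is a
  bijection from the following set of pairs onto \<open>'k\<close>.
\<close>

definition coord_pairs :: "nat \<Rightarrow> (nat \<Rightarrow> nat) \<Rightarrow> (nat \<times> nat) set" where
  "coord_pairs n c = (SIGMA i:{1..n}. {1..c i + 1})"

definition coordinate_labelling :: "nat \<Rightarrow> (nat \<Rightarrow> nat) \<Rightarrow> (nat \<times> nat \<Rightarrow> 'k::finite) \<Rightarrow> bool" where
  "coordinate_labelling n c pos \<longleftrightarrow> bij_betw pos (coord_pairs n c) UNIV"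

text \<open>
  The factor space of dimension \<open>c i + 1\<close> is identified with the coordinate subspace of \<open>real^'k\<close>
  spanned by the unit vectors of block \<open>i\<close>; \<open>factor_part\<close> is the projection onto it.
\<close>

definition factor_simplex :: "(nat \<Rightarrow> nat) \<Rightarrow> (nat \<times> nat \<Rightarrow> 'k::finite) \<Rightarrow> nat \<Rightarrow> (real^'k) set" where
  "factor_simplex c pos i = convex hull ((\<lambda>j. axis (pos (i, j)) 1) ` {1..c i + 1})"

definition factor_part :: "(nat \<Rightarrow> nat) \<Rightarrow> (nat \<times> nat \<Rightarrow> 'k::finite) \<Rightarrow> nat \<Rightarrow> real^'k \<Rightarrow> real^'k" where
  "factor_part c pos i x = (\<Sum>j = 1..c i + 1. vec_nth x (pos (i, j)) *\<^sub>R axis (pos (i, j)) 1)"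

definition simplotope :: "nat \<Rightarrow> (nat \<Rightarrow> nat) \<Rightarrow> (nat \<times> nat \<Rightarrow> 'k::finite) \<Rightarrow> (real^'k) set" where
  "simplotope n c pos = {x. \<forall>i\<in>{1..n}. factor_part c pos i x \<in> factor_simplex c pos i}"

definition vertex_triangulation :: "'a::euclidean_space set set \<Rightarrow> 'a set \<Rightarrow> bool" where
  "vertex_triangulation \<T> P \<longleftrightarrow>
     triangulation \<T> \<and> \<Union>\<T> = P \<and>
     (\<forall>S\<in>\<T>. \<forall>w. w extreme_point_of S \<longrightarrow> w extreme_point_of P)"

definition coordinate_list :: "nat \<Rightarrow> (nat \<Rightarrow> nat) \<Rightarrow> (nat \<times> nat \<Rightarrow> 'k) \<Rightarrow> 'k list" where
  "coordinate_list n c pos = concat (map (\<lambda>i. map (\<lambda>j. pos (i, j)) [1..<c i + 2]) [1..<n + 1])"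

text \<open>
  A vertex \<open>v\<close> of the simplotope has exactly one coordinate equal to 1 in each factor, so the filter
  deletes one coordinate per factor and leaves a list of length \<open>\<Sum>i = 1..n. c i\<close>.
\<close>

definition reduced_coordinates ::
    "nat \<Rightarrow> (nat \<Rightarrow> nat) \<Rightarrow> (nat \<times> nat \<Rightarrow> 'k::finite) \<Rightarrow> real^'k \<Rightarrow> real^'k \<Rightarrow> real list" where
  "reduced_coordinates n c pos v x =
     map (vec_nth x) (filter (\<lambda>k. vec_nth v k \<noteq> 1) (coordinate_list n c pos))"

text \<open>
  The bordered matrix needs the vertices of the simplex in some order, so it takes a list \<open>ws\<close>
  enumerating them.
\<close>

definition class_matrix ::
    "nat \<Rightarrow> (nat \<Rightarrow> nat) \<Rightarrow> (nat \<times> nat \<Rightarrow> 'k::finite) \<Rightarrow> real^'k \<Rightarrow> (real^'k) list \<Rightarrow> real mat" where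
  "class_matrix n c pos v ws =
     mat_of_rows_list ((\<Sum>i = 1..n. c i) + 1) (map (\<lambda>w. 1 # reduced_coordinates n c pos v w) ws)"

definition simplex_class ::
    "nat \<Rightarrow> (nat \<Rightarrow> nat) \<Rightarrow> (nat \<times> nat \<Rightarrow> 'k::finite) \<Rightarrow> real^'k \<Rightarrow> (real^'k) list \<Rightarrow> real" where
  "simplex_class n c pos v ws = \<bar>Determinant.det (class_matrix n c pos v ws)\<bar>"

end

theory Submission
  imports Defs
begin

text \<open>
  On the simplotope every standard coordinate is an integer combination of \<open>1\<close> and the reduced
  coordinates with respect to any vertex, because the coordinates of each block sum to \<open>1\<close>.
  Hence two bordered matrices, for different vertices and different orders of the rows, arise from
  each other by multiplication with integer matrices. So each determinant is an integer multiple of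
  the other one, and this forces equal absolute values.
\<close>

section \<open>Determinants under integer matrix factors\<close>

lemma det_Ints:
  fixes A :: "real mat"
  assumes "A \<in> carrier_mat m m" and "\<And>i j. i < m \<Longrightarrow> j < m \<Longrightarrow> A $$ (i, j) \<in> \<int>"
  shows "Determinant.det A \<in> \<int>"
  unfolding det_def'[OF assms(1)]
proof (intro Ints_sum Ints_mult Ints_prod)
  fix p assume "p \<in> {p. p permutes {0..<m}}"
  then show "A $$ (i, p i) \<in> \<int>" if "i \<in> {0..<m}" for i
    using assms(2) that permutes_in_image[of p "{0..<m}" i] by auto
qed (simp add: sign_def)

text \<open>The matrix on the left factors as \<open>P * M * B\<close>: \<open>P\<close> selects
  rows, turning the points of \<open>ws\<close> into those of \<open>ws'\<close>, and
  \<open>B\<close> holds the coefficients that turn the functions \<open>g\<close> into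
  \<open>g'\<close>. The multiplier is the product of the two integer determinants. Inverses never
  enter, since the lemma will be used in both directions.\<close>

lemma det_integer_multiple:
  fixes g g' :: "nat \<Rightarrow> 'b \<Rightarrow> real"
  assumes ws: "distinct ws" "length ws = m" and ws': "length ws' = m" "set ws' \<subseteq> set ws"
    and A: "\<And>d e. A d e \<in> \<int>"
    and g': "\<And>x e. x \<in> set ws \<Longrightarrow> e < m \<Longrightarrow> g' e x = (\<Sum>d<m. g d x * A d e)"
  shows "\<exists>p\<in>\<int>. Determinant.det (mat m m (\<lambda>(r, e). g' e (ws' ! r))) =
    p * Determinant.det (mat m m (\<lambda>(r, e). g e (ws ! r)))"
proof -
  define P where "P = mat m m (\<lambda>(r, s). if ws ! s = ws' ! r then 1 else 0 :: real)"
  define B where "B = mat m m (\<lambda>(d, e). A d e)"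
  define M where "M = mat m m (\<lambda>(r, e). g e (ws ! r))"
  have carr: "P \<in> carrier_mat m m" "B \<in> carrier_mat m m" "M \<in> carrier_mat m m"
    by (auto simp: P_def B_def M_def)
  have PM: "(P * M) $$ (r, d) = g d (ws' ! r)" if "r < m" "d < m" for r d
  proof -
    have "ws' ! r \<in> set ws" using that ws' by auto
    then obtain s0 where s0: "s0 < m" "ws ! s0 = ws' ! r"
      using ws by (metis in_set_conv_nth)
    have "(P * M) $$ (r, d) = (\<Sum>s<m. (if ws ! s = ws' ! r then 1 else 0) * g d (ws ! s))"
      using that by (simp add: P_def M_def scalar_prod_def lessThan_atLeast0)
    also have "\<dots> = (\<Sum>s<m. if s = s0 then g d (ws' ! r) else 0)"
    proof (intro sum.cong refl)
      fix s assume "s \<in> {..<m}"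
      \<comment> \<open>Because \<open>ws\<close> is distinct, each row of \<open>P\<close> has a
        single 1, so left multiplication picks out one row of \<open>M\<close>.\<close>
      then have "ws ! s = ws' ! r \<longleftrightarrow> s = s0"
        using s0 ws nth_eq_iff_index_eq[of ws s s0] by simp
      then show "(if ws ! s = ws' ! r then 1 else 0) * g d (ws ! s) =
          (if s = s0 then g d (ws' ! r) else 0)"
        using s0 by simp
    qed
    also have "\<dots> = g d (ws' ! r)" using s0 by simp
    finally show ?thesis .
  qed
  have "mat m m (\<lambda>(r, e). g' e (ws' ! r)) = P * M * B"
  proof (rule eq_matI)
    fix r e assume "r < dim_row (P * M * B)" "e < dim_col (P * M * B)"
    then have re: "r < m" "e < m" by (auto simp: P_def B_def)
    have "(P * M * B) $$ (r, e) = (\<Sum>d<m. (P * M) $$ (r, d) * A d e)"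
      using re carr by (auto simp: scalar_prod_def lessThan_atLeast0 B_def intro!: sum.cong)
    also have "\<dots> = (\<Sum>d<m. g d (ws' ! r) * A d e)"
      using re by (intro sum.cong) (auto simp: PM)
    also have "\<dots> = g' e (ws' ! r)"
      using re ws' by (intro g'[symmetric]) auto
    finally show "mat m m (\<lambda>(r, e). g' e (ws' ! r)) $$ (r, e) = (P * M * B) $$ (r, e)"
      using re by simp
  qed (auto simp: P_def B_def)
  then have "Determinant.det (mat m m (\<lambda>(r, e). g' e (ws' ! r))) =
      (Determinant.det P * Determinant.det B) * Determinant.det M"
    using carr by (simp add: det_mult[of _ m])
  moreover have "Determinant.det P \<in> \<int>" "Determinant.det B \<in> \<int>"
    by (auto intro!: det_Ints[of _ m] simp: P_def B_def A)
  ultimately show ?thesis unfolding M_def by (metis Ints_mult)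
qed

text \<open>If one number vanishes, so does the other; otherwise \<open>p * q = 1\<close> over the
  integers, and the only integer units are 1 and -1.\<close>

lemma abs_eq_if_integer_multiples:
  fixes x y :: real
  assumes "p \<in> \<int>" "q \<in> \<int>" and "x = p * y" "y = q * x"
  shows "\<bar>x\<bar> = \<bar>y\<bar>"
proof (cases "y = 0")
  case False
  from assms obtain a b where ab: "p = of_int a" "q = of_int b" by (auto elim!: Ints_cases)
  have "y = q * (p * y)" using assms(4) unfolding assms(3) .
  then have "of_int (a * b) * y = y" unfolding ab by (simp only: of_int_mult mult_ac)
  then have "of_int (a * b) = (1 :: real)"
    using False by (metis mult_cancel_right mult_1)
  then have "a * b = 1" by linarith
  then have "\<bar>a\<bar> = 1" using zmult_eq_1_iff by auto
  then have "\<bar>p\<bar> = 1" using ab by (metis of_int_abs of_int_1)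
  then show ?thesis using assms(3) by (simp add: abs_mult)
qed (simp add: assms(3))

text \<open>This is the shape needed for \<open>det_integer_multiple\<close>: column
  \<open>e\<close> is a fixed function evaluated at the vertices in the list.\<close>

lemma class_matrix_eq:
  fixes ws :: "(real^'k::finite) list"
  assumes "length ws = (\<Sum>i = 1..n. c i) + 1"
  shows "class_matrix n c pos v ws = mat ((\<Sum>i = 1..n. c i) + 1) ((\<Sum>i = 1..n. c i) + 1)
    (\<lambda>(r, e). (1 # reduced_coordinates n c pos v (ws ! r)) ! e)"
  using assms by (intro eq_matI) (auto simp: class_matrix_def mat_of_rows_list_def)

section \<open>Membership in the simplotope in terms of coordinates\<close>

context
  fixes n :: nat and c :: "nat \<Rightarrow> nat" and pos :: "nat \<times> nat \<Rightarrow> 'k::finite"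
  assumes lab: "coordinate_labelling n c pos"
begin

lemma pos_eq_iff:
  assumes "i \<in> {1..n}" "j \<in> {1..c i + 1}" "i' \<in> {1..n}" "j' \<in> {1..c i' + 1}"
  shows "pos (i, j) = pos (i', j') \<longleftrightarrow> i = i' \<and> j = j'"
proof -
  have "inj_on pos (coord_pairs n c)"
    using lab by (auto simp: coordinate_labelling_def bij_betw_def)
  moreover have "(i, j) \<in> coord_pairs n c" "(i', j') \<in> coord_pairs n c"
    using assms by (auto simp: coord_pairs_def)
  ultimately show ?thesis by (auto simp: inj_on_def)
qed

lemma pos_exhaust:
  obtains i j where "i \<in> {1..n}" "j \<in> {1..c i + 1}" "k = pos (i, j)"
proof -
  have "k \<in> pos ` coord_pairs n c"
    using lab by (auto simp: coordinate_labelling_def bij_betw_def)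
  then show ?thesis using that by (auto simp: coord_pairs_def)
qed

lemma factor_part_nth:
  assumes "i \<in> {1..n}" "j \<in> {1..c i + 1}"
  shows "vec_nth (factor_part c pos i x) (pos (i, j)) = vec_nth x (pos (i, j))"
proof -
  have "vec_nth (factor_part c pos i x) (pos (i, j)) =
      (\<Sum>j' = 1..c i + 1. if j' = j then vec_nth x (pos (i, j)) else 0)"
    unfolding factor_part_def sum_component
    using assms by (intro sum.cong) (auto simp: axis_def pos_eq_iff)
  also have "\<dots> = vec_nth x (pos (i, j))" using assms by (simp del: sum.cl_ivl_Suc)
  finally show ?thesis .
qed

text \<open>Each factor is a standard simplex. Forwards, the block conditions define a convex set
  containing the unit vectors of the block, hence their hull. Backwards, the coordinates in a block
  are themselves the weights of a convex combination of these unit vectors.\<close>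

lemma mem_simplotope_iff:
  "x \<in> simplotope n c pos \<longleftrightarrow>
    (\<forall>k. 0 \<le> vec_nth x k) \<and> (\<forall>i\<in>{1..n}. (\<Sum>j = 1..c i + 1. vec_nth x (pos (i, j))) = 1)"
    (is "?L \<longleftrightarrow> ?R")
proof
  assume L: ?L
  have block: "(\<forall>j\<in>{1..c i + 1}. 0 \<le> vec_nth x (pos (i, j))) \<and>
      (\<Sum>j = 1..c i + 1. vec_nth x (pos (i, j))) = 1" if i: "i \<in> {1..n}" for i
  proof -
    define H where "H = {y :: real^'k. (\<forall>j\<in>{1..c i + 1}. 0 \<le> vec_nth y (pos (i, j))) \<and>
      (\<Sum>j = 1..c i + 1. vec_nth y (pos (i, j))) = 1}"
    have "convex H"
      unfolding convex_def H_def
      by (auto simp: sum.distrib simp flip: sum_distrib_left simp del: sum.cl_ivl_Suc)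
    moreover have "axis (pos (i, j)) 1 \<in> H" if j: "j \<in> {1..c i + 1}" for j
    proof -
      have "(\<Sum>j' = 1..c i + 1. vec_nth (axis (pos (i, j)) 1 :: real^'k) (pos (i, j'))) =
          (\<Sum>j' = 1..c i + 1. if j' = j then 1 else 0)"
        using i j by (intro sum.cong) (auto simp: axis_def pos_eq_iff)
      also have "\<dots> = 1" using j by (simp del: sum.cl_ivl_Suc)
      finally show ?thesis by (simp add: H_def axis_def del: sum.cl_ivl_Suc)
    qed
    ultimately have "factor_simplex c pos i \<subseteq> H"
      unfolding factor_simplex_def by (intro hull_minimal) auto
    then have "factor_part c pos i x \<in> H" using L i by (auto simp: simplotope_def)
    then show ?thesis using i by (simp add: H_def factor_part_nth del: sum.cl_ivl_Suc)
  qed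
  have "0 \<le> vec_nth x k" for k
    by (rule pos_exhaust[of k]) (use block in auto)
  with block show ?R by blast
next
  assume R: ?R
  have "factor_part c pos i x \<in> factor_simplex c pos i" if i: "i \<in> {1..n}" for i
    unfolding factor_part_def factor_simplex_def
    using R i by (intro convex_sum) (auto intro: hull_inc simp del: sum.cl_ivl_Suc)
  then show ?L by (simp add: simplotope_def)
qed

section \<open>Vertices of the simplotope\<close>

lemma simplotope_perturb:
  assumes v: "v \<in> simplotope n c pos" and i: "i \<in> {1..n}"
    and j: "a \<in> {1..c i + 1}" "b \<in> {1..c i + 1}" "a \<noteq> b"
    and t: "- vec_nth v (pos (i, a)) \<le> t" "t \<le> vec_nth v (pos (i, b))"
  shows "v + t *\<^sub>R (axis (pos (i, a)) 1 - axis (pos (i, b)) 1) \<in> simplotope n c pos"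
    (is "?w \<in> _")
  unfolding mem_simplotope_iff
proof (intro conjI allI ballI)
  have "pos (i, a) \<noteq> pos (i, b)" using i j by (simp add: pos_eq_iff)
  \<comment> \<open>Only the two coordinates \<open>pos (i, a)\<close> and \<open>pos (i, b)\<close>
    change, and the bounds on \<open>t\<close> keep both nonnegative.\<close>
  then show "0 \<le> vec_nth ?w k" for k
    using v t unfolding mem_simplotope_iff by (auto simp: axis_def)
next
  fix i' assume i': "i' \<in> {1..n}"
  \<comment> \<open>The two unit vectors contribute equally to every block sum, so their difference
    leaves all block sums at 1.\<close>
  have axis_sum: "(\<Sum>j' = 1..c i' + 1. vec_nth (axis (pos (i, j)) 1 :: real^'k) (pos (i', j'))) =
      (if i' = i then 1 else 0)" if "j \<in> {1..c i + 1}" for j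
  proof -
    have "(\<Sum>j' = 1..c i' + 1. vec_nth (axis (pos (i, j)) 1 :: real^'k) (pos (i', j'))) =
        (\<Sum>j' = 1..c i' + 1. if j' = j then if i' = i then 1 else 0 else 0)"
      using i i' that by (intro sum.cong) (auto simp: axis_def pos_eq_iff)
    also have "\<dots> = (if i' = i then 1 else 0)" using that by (simp del: sum.cl_ivl_Suc)
    finally show ?thesis .
  qed
  have "(\<Sum>j' = 1..c i' + 1. vec_nth ?w (pos (i', j'))) =
      (\<Sum>j' = 1..c i' + 1. vec_nth v (pos (i', j')))"
    using axis_sum[OF j(1)] axis_sum[OF j(2)]
    by (simp add: sum.distrib sum_subtractf del: sum.cl_ivl_Suc flip: sum_distrib_left)
  then show "(\<Sum>j' = 1..c i' + 1. vec_nth ?w (pos (i', j'))) = 1"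
    using v i' unfolding mem_simplotope_iff by (simp del: sum.cl_ivl_Suc)
qed

text \<open>If two coordinates of a block were positive, shifting a little weight from one to the
  other and back would exhibit \<open>v\<close> as the midpoint of two other points of the
  simplotope. So a block has one nonzero coordinate, and the block sum makes it 1.\<close>

lemma extreme_point_block:
  assumes v: "v extreme_point_of simplotope n c pos" and i: "i \<in> {1..n}"
  shows "\<exists>a\<in>{1..c i + 1}. \<forall>j\<in>{1..c i + 1}. vec_nth v (pos (i, j)) = (if j = a then 1 else 0)"
proof -
  have vS: "v \<in> simplotope n c pos" using v by (simp add: extreme_point_of_def)
  have nn: "0 \<le> vec_nth v k" for k using vS by (simp add: mem_simplotope_iff)
  have s1: "(\<Sum>j = 1..c i + 1. vec_nth v (pos (i, j))) = 1"
    using vS i unfolding mem_simplotope_iff by blast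
  then obtain a where a: "a \<in> {1..c i + 1}" "vec_nth v (pos (i, a)) \<noteq> 0"
    by (metis sum.neutral zero_neq_one)
  have zero: "vec_nth v (pos (i, b)) = 0" if b: "b \<in> {1..c i + 1}" "b \<noteq> a" for b
  proof (rule ccontr)
    assume nz: "vec_nth v (pos (i, b)) \<noteq> 0"
    \<comment> \<open>The smaller of the two coordinates is the largest step that stays inside the
      simplotope in both directions \<open>u\<close> and \<open>- u\<close>.\<close>
    define t where "t = min (vec_nth v (pos (i, a))) (vec_nth v (pos (i, b)))"
    define u :: "real^'k" where "u = axis (pos (i, a)) 1 - axis (pos (i, b)) 1"
    have t: "t > 0" using nz a nn[of "pos (i, a)"] nn[of "pos (i, b)"] by (simp add: t_def)
    have "pos (i, a) \<noteq> pos (i, b)" using i a b by (simp add: pos_eq_iff)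
    then have "vec_nth u (pos (i, a)) = 1" by (simp add: u_def axis_def)
    then have "u \<noteq> 0" by auto
    have "v + t *\<^sub>R u \<in> simplotope n c pos" "v + (- t) *\<^sub>R u \<in> simplotope n c pos"
      unfolding u_def using vS i a b nn[of "pos (i, a)"] nn[of "pos (i, b)"]
      by (auto intro!: simplotope_perturb simp: t_def simp del: scaleR_minus_left)
    moreover have "v \<in> open_segment (v + t *\<^sub>R u) (v + (- t) *\<^sub>R u)"
    proof -
      have "midpoint (v + t *\<^sub>R u) (v + (- t) *\<^sub>R u) = v"
        by (simp add: midpoint_def flip: scaleR_2)
      moreover have "v + t *\<^sub>R u \<noteq> v + (- t) *\<^sub>R u" using t \<open>u \<noteq> 0\<close>
        by (metis add_left_cancel less_irrefl neg_less_0_iff_less order.strict_trans scaleR_cancel_right)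
      ultimately show ?thesis by (metis midpoint_in_open_segment)
    qed
    ultimately show False using v by (auto simp: extreme_point_of_def)
  qed
  have "(\<Sum>j = 1..c i + 1. vec_nth v (pos (i, j))) =
      (\<Sum>j = 1..c i + 1. if j = a then vec_nth v (pos (i, a)) else 0)"
    using zero by (intro sum.cong) auto
  also have "\<dots> = vec_nth v (pos (i, a))" using a by (simp del: sum.cl_ivl_Suc)
  finally have "vec_nth v (pos (i, a)) = 1" using s1 by simp
  with zero a show ?thesis by (intro bexI[of _ a]) auto
qed

section \<open>Counting the standard and the reduced coordinates\<close>

lemma set_coordinate_list: "set (coordinate_list n c pos) = UNIV"
proof -
  have "k \<in> set (coordinate_list n c pos)" for k
  proof (rule pos_exhaust[of k])
    fix i j assume "i \<in> {1..n}" "j \<in> {1..c i + 1}" "k = pos (i, j)"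
    then show ?thesis
      by (auto simp: coordinate_list_def simp del: upt_Suc intro!: bexI[of _ i])
  qed
  then show ?thesis by blast
qed

lemma length_coordinate_list: "length (coordinate_list n c pos) = (\<Sum>i = 1..n. c i + 1)"
  by (simp add: coordinate_list_def length_concat comp_def interv_sum_list_conv_sum_set_nat
      atLeastLessThanSuc_atLeastAtMost del: upt_Suc)

lemma card_UNIV_coordinates: "card (UNIV :: 'k set) = (\<Sum>i = 1..n. c i + 1)"
proof -
  have "card (coord_pairs n c) = card (UNIV :: 'k set)"
    using lab by (auto simp: coordinate_labelling_def dest: bij_betw_same_card)
  then show ?thesis by (simp add: coord_pairs_def)
qed

text \<open>A list that covers a finite type and is only as long as its cardinality cannot repeat an
  entry.\<close>

lemma distinct_coordinate_list: "distinct (coordinate_list n c pos)"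
  by (simp add: card_distinct set_coordinate_list length_coordinate_list card_UNIV_coordinates)

text \<open>One coordinate per block is deleted, so \<open>n\<close> of the N + n standard
  coordinates disappear. This is what makes the bordered matrix square.\<close>

lemma length_reduced:
  assumes v: "v extreme_point_of simplotope n c pos"
  shows "length (filter (\<lambda>k. vec_nth v k \<noteq> 1) (coordinate_list n c pos)) = (\<Sum>i = 1..n. c i)"
proof -
  from extreme_point_block[OF v] obtain a where
    a: "\<And>i. i \<in> {1..n} \<Longrightarrow> a i \<in> {1..c i + 1}"
    and va: "\<And>i j. i \<in> {1..n} \<Longrightarrow> j \<in> {1..c i + 1} \<Longrightarrow>
        vec_nth v (pos (i, j)) = (if j = a i then 1 else 0)"
    by metis
  have "{k. vec_nth v k = 1} = (\<lambda>i. pos (i, a i)) ` {1..n}"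
  proof (intro subset_antisym subsetI)
    fix k assume k: "k \<in> {k. vec_nth v k = 1}"
    show "k \<in> (\<lambda>i. pos (i, a i)) ` {1..n}"
      by (rule pos_exhaust[of k]) (use k va in \<open>auto split: if_splits\<close>)
  qed (use a va in auto)
  moreover have "inj_on (\<lambda>i. pos (i, a i)) {1..n}"
    using a by (intro inj_onI) (simp add: pos_eq_iff)
  ultimately have ones: "card {k. vec_nth v k = 1} = n" by (simp add: card_image)
  have "length (filter (\<lambda>k. vec_nth v k \<noteq> 1) (coordinate_list n c pos)) =
      card (- {k. vec_nth v k = 1})"
    using distinct_card[OF distinct_filter[OF distinct_coordinate_list, of "\<lambda>k. vec_nth v k \<noteq> 1"]]
    by (simp add: set_coordinate_list Compl_eq)
  also have "\<dots> = (\<Sum>i = 1..n. c i)"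
    using ones by (simp add: Compl_eq_Diff_UNIV card_Diff_subset card_UNIV_coordinates sum.distrib sum_Suc)
  finally show ?thesis .
qed

section \<open>Integer change of reduced coordinates\<close>

lemma coordinate_integer_combination:
  assumes v: "v extreme_point_of simplotope n c pos"
  shows "\<exists>s t. s \<in> \<int> \<and> (\<forall>k'. t k' \<in> \<int>) \<and> (\<forall>x\<in>simplotope n c pos.
    vec_nth x k = s + (\<Sum>k' | vec_nth v k' \<noteq> 1. vec_nth x k' * t k'))"
proof (cases "vec_nth v k = 1")
  case False
  then show ?thesis
    by (intro exI[of _ 0] exI[of _ "\<lambda>k'. if k' = k then 1 else 0"])
       (auto simp: if_distrib cong: if_cong)
next
  case True
  obtain i j where ij: "i \<in> {1..n}" "j \<in> {1..c i + 1}" and k: "k = pos (i, j)"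
    by (rule pos_exhaust)
  define Bl where "Bl = (\<lambda>j. pos (i, j)) ` {1..c i + 1}"
  \<comment> \<open>Since \<open>v\<close> has its single 1 of block \<open>i\<close> at
    \<open>k\<close>, all other coordinates of this block survive the deletion.\<close>
  have "Bl - {k} = {k'. vec_nth v k' \<noteq> 1} \<inter> Bl"
  proof -
    from extreme_point_block[OF v ij(1)] obtain a where "a \<in> {1..c i + 1}" and
      va: "\<And>j'. j' \<in> {1..c i + 1} \<Longrightarrow> vec_nth v (pos (i, j')) = (if j' = a then 1 else 0)"
      by blast
    moreover have "a = j" using va[OF ij(2)] True k by (simp split: if_splits)
    ultimately show ?thesis
      using ij by (force simp: Bl_def k pos_eq_iff va)
  qed
  moreover have "vec_nth x k = 1 - (\<Sum>k'\<in>Bl - {k}. vec_nth x k')" if "x \<in> simplotope n c pos" for x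
  proof -
    have "inj_on (\<lambda>j. pos (i, j)) {1..c i + 1}"
      using ij by (intro inj_onI) (simp add: pos_eq_iff)
    then have "(\<Sum>k'\<in>Bl. vec_nth x k') = 1"
      using that ij unfolding mem_simplotope_iff Bl_def by (simp add: sum.reindex del: sum.cl_ivl_Suc)
    moreover have "k \<in> Bl" using ij k by (auto simp: Bl_def)
    ultimately show ?thesis by (simp add: sum_diff1)
  qed
  ultimately show ?thesis
    \<comment> \<open>The deleted coordinate is 1 minus the rest of its block. The weight -1 at
      \<open>k\<close> itself is harmless, as the sum runs only over coordinates where
      \<open>v\<close> differs from 1.\<close>
    by (intro exI[of _ 1] exI[of _ "\<lambda>k'. if k' \<in> Bl then - 1 else 0"])
       (auto simp: if_distrib sum.If_cases sum_negf cong: if_cong)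
qed

lemma bordered_coordinate_integer_combination:
  assumes v: "v extreme_point_of simplotope n c pos"
  shows "\<exists>A. (\<forall>d. A d \<in> \<int>) \<and> (\<forall>x\<in>simplotope n c pos. vec_nth x k =
    (\<Sum>d < (\<Sum>i = 1..n. c i) + 1. (1 # reduced_coordinates n c pos v x) ! d * A d))"
proof -
  define fl where "fl = filter (\<lambda>k. vec_nth v k \<noteq> 1) (coordinate_list n c pos)"
  from coordinate_integer_combination[OF v, of k] obtain s t where
    st: "s \<in> \<int>" "\<And>k'. t k' \<in> \<int>" and
    x: "\<And>x. x \<in> simplotope n c pos \<Longrightarrow>
      vec_nth x k = s + (\<Sum>k' | vec_nth v k' \<noteq> 1. vec_nth x k' * t k')"
    by blast
  have len: "length fl = (\<Sum>i = 1..n. c i)" using length_reduced[OF v] by (simp add: fl_def)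
  have set: "set fl = {k'. vec_nth v k' \<noteq> 1}" by (simp add: fl_def set_coordinate_list)
  have dist: "distinct fl" by (simp add: fl_def distinct_coordinate_list)
  show ?thesis
  \<comment> \<open>Index 0 of the bordered row is the leading 1, so it carries the constant
    \<open>s\<close>; the reduced coordinates are shifted by one.\<close>
  proof (intro exI[of _ "\<lambda>d. case d of 0 \<Rightarrow> s | Suc d \<Rightarrow> t (fl ! d)"] conjI ballI allI)
    fix x assume "x \<in> simplotope n c pos"
    then have "vec_nth x k = s + (\<Sum>k'\<in>set fl. vec_nth x k' * t k')"
      using x set by simp
    also have "(\<Sum>k'\<in>set fl. vec_nth x k' * t k') =
        (\<Sum>d < length fl. vec_nth x (fl ! d) * t (fl ! d))"
      by (rule sum.reindex_bij_betw[OF bij_betw_nth[OF dist refl refl], symmetric])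
    finally show "vec_nth x k = (\<Sum>d < (\<Sum>i = 1..n. c i) + 1.
        (1 # reduced_coordinates n c pos v x) ! d * (case d of 0 \<Rightarrow> s | Suc d \<Rightarrow> t (fl ! d)))"
      unfolding len[symmetric]
      by (simp add: sum.lessThan_Suc_shift reduced_coordinates_def fl_def[symmetric]
          del: sum.lessThan_Suc)
  qed (use st in \<open>auto split: nat.split\<close>)
qed

text \<open>Every column of the matrix for \<open>v'\<close> is an integer combination of the
  columns for \<open>v\<close>, with coefficients that are the same for all points of the
  simplotope, hence for all rows.\<close>

lemma det_class_matrix_integer_multiple:
  assumes v: "v extreme_point_of simplotope n c pos" and v': "v' extreme_point_of simplotope n c pos"
    and ws: "distinct ws" "length ws = (\<Sum>i = 1..n. c i) + 1" "set ws \<subseteq> simplotope n c pos"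
    and ws': "length ws' = (\<Sum>i = 1..n. c i) + 1" "set ws' \<subseteq> set ws"
  shows "\<exists>p\<in>\<int>. Determinant.det (class_matrix n c pos v' ws') =
    p * Determinant.det (class_matrix n c pos v ws)"
proof -
  define m where "m = (\<Sum>i = 1..n. c i) + 1"
  define g where "g u d x = (1 # reduced_coordinates n c pos u x) ! d" for u d x
  define fl where "fl = filter (\<lambda>k. vec_nth v' k \<noteq> 1) (coordinate_list n c pos)"
  have len: "m = Suc (length fl)" using length_reduced[OF v'] by (simp add: fl_def m_def)
  have "\<exists>A. (\<forall>d. A d \<in> \<int>) \<and> (\<forall>x\<in>simplotope n c pos. e < m \<longrightarrow>
      g v' e x = (\<Sum>d<m. g v d x * A d))" for e
  proof (cases e)
    case 0
    \<comment> \<open>The column of ones is common to both matrices and is reproduced by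
      itself.\<close>
    have "(\<Sum>d<m. g v d x * (if d = 0 then 1 else 0)) = 1" for x
      by (simp add: g_def m_def if_distrib sum.lessThan_Suc_shift cong: if_cong
          del: sum.lessThan_Suc)
    then show ?thesis using 0
      by (intro exI[of _ "\<lambda>d. if d = 0 then 1 else 0"]) (auto simp: g_def[of v'])
  next
    case (Suc e')
    \<comment> \<open>The guard \<open>e < m\<close> keeps \<open>e'\<close> within the list
      \<open>fl\<close>, so that this entry is a genuine coordinate of \<open>x\<close>.\<close>
    have "g v' e x = vec_nth x (fl ! e')" if "e < m" for x
      using that Suc len by (simp add: g_def reduced_coordinates_def fl_def[symmetric])
    moreover obtain A where "\<forall>d. A d \<in> \<int>"
      "\<forall>x\<in>simplotope n c pos. vec_nth x (fl ! e') = (\<Sum>d<m. g v d x * A d)"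
      using bordered_coordinate_integer_combination[OF v, of "fl ! e'"]
      unfolding g_def m_def by blast
    ultimately show ?thesis by (intro exI[of _ A]) simp
  qed
  then obtain A where "\<And>d e. A e d \<in> \<int>"
    "\<And>x e. x \<in> simplotope n c pos \<Longrightarrow> e < m \<Longrightarrow> g v' e x = (\<Sum>d<m. g v d x * A e d)"
    by metis
  then have "\<exists>p\<in>\<int>. Determinant.det (mat m m (\<lambda>(r, e). g v' e (ws' ! r))) =
      p * Determinant.det (mat m m (\<lambda>(r, e). g v e (ws ! r)))"
    using ws ws' by (intro det_integer_multiple[where A = "\<lambda>d e. A e d"]) (auto simp: m_def)
  then show ?thesis
    unfolding class_matrix_eq[OF ws(2)] class_matrix_eq[OF ws'(1)] g_def m_def .
qed

end

theorem theorem3: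
  fixes n :: nat and c :: "nat \<Rightarrow> nat" and pos :: "nat \<times> nat \<Rightarrow> 'k::finite"
    and \<T> :: "(real^'k) set set" and \<alpha> :: "(real^'k) set"
    and v v' :: "real^'k" and ws ws' :: "(real^'k) list"
  assumes "coordinate_labelling n c pos"
    and "vertex_triangulation \<T> (simplotope n c pos)"
    and "\<alpha> \<in> \<T>"
    and "int (\<Sum>i = 1..n. c i) simplex \<alpha>"
    and "v extreme_point_of simplotope n c pos"
    and "v' extreme_point_of simplotope n c pos"
    and "distinct ws" and "set ws = {w. w extreme_point_of \<alpha>}"
    and "distinct ws'" and "set ws' = {w. w extreme_point_of \<alpha>}"
  shows "simplex_class n c pos v ws = simplex_class n c pos v' ws'"
proof -
  let ?N = "\<Sum>i = 1..n. c i"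
  obtain C where C: "\<not> affine_dependent C" "int (card C) = int ?N + 1" "\<alpha> = convex hull C"
    using assms(4) by (auto simp: simplex)
  \<comment> \<open>The vertices of a simplex are its affinely independent generators, so both lists
    have N + 1 entries and both matrices are square.\<close>
  have "{w. w extreme_point_of \<alpha>} = C"
    using extreme_point_of_convex_hull_affine_independent[OF C(1)] C(3) by auto
  moreover have "card C = ?N + 1" using C(2) by linarith
  ultimately have len: "length ws = ?N + 1" "length ws' = ?N + 1"
    using assms(7-10) distinct_card[of ws] distinct_card[of ws'] by auto
  have sub: "set ws \<subseteq> simplotope n c pos" "set ws' \<subseteq> simplotope n c pos"
    using assms(2,3,8,10) by (auto simp: vertex_triangulation_def extreme_point_of_def)
  have sets: "set ws' \<subseteq> set ws" "set ws \<subseteq> set ws'" using assms(8,10) by auto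
  show ?thesis
    \<comment> \<open>Exchanging the roles of the two vertices and the two lists gives integer
      multiples in both directions.\<close>
    using det_class_matrix_integer_multiple[OF assms(1,5,6,7) len(1) sub(1) len(2) sets(1)]
      det_class_matrix_integer_multiple[OF assms(1,6,5,9) len(2) sub(2) len(1) sets(2)]
    unfolding simplex_class_def by (elim bexE) (rule abs_eq_if_integer_multiples)
qed

end
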